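(* If there is a model of $\mathrm{ZFC}$, then there is a model of $\mathrm{ZFC}$ with a maximal $\Sigma_2$ theory.
   Context: A model $M\models\mathrm{ZFC}$ has a maximal $\Sigma_2$ theory if the $\Sigma_2$ fragment of the theory of $M$ (the set of $\Sigma_2$ sentences, in the Lévy hierarchy and without parameters, true in $M$) is a maximal consistent $\Sigma_2$ extension of $\mathrm{ZFC}$; in other words, any $\Sigma_2$ sentence $\sigma$ that is consistent with $\mathrm{ZFC}$ plus the $\Sigma_2$ theory of $M$ is already true in $M$. Models are arbitrary first-order models, not necessarily well-founded. *)

theory Defs
  imports Main
begin

section \<open>First-order formulas in the language of set theory\<close>

text \<open>
  Variables are de Bruijn indices: index 0 refers to the innermost enclosing quantifier.
  The language is purely relational, so variables are the only terms, and substitution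
  of terms for variables is renaming.
\<close>

datatype fm =
    Mem nat nat  (infix "\<^bold>\<in>" 80)
  | Equ nat nat  (infix "\<^bold>=" 80)
  | Bot          ("\<^bold>\<bottom>")
  | Imp fm fm    (infixr "\<^bold>\<longrightarrow>" 55)
  | Con fm fm    (infixr "\<^bold>\<and>" 65)
  | Dis fm fm    (infixr "\<^bold>\<or>" 60)
  | Uni fm       ("\<^bold>\<forall> _" [70] 70)
  | Exi fm       ("\<^bold>\<exists> _" [70] 70)

abbreviation Neg :: "fm \<Rightarrow> fm"  ("\<^bold>\<not> _" [70] 70)
  where "\<^bold>\<not> \<phi> \<equiv> \<phi> \<^bold>\<longrightarrow> \<^bold>\<bottom>"

abbreviation Iff :: "fm \<Rightarrow> fm \<Rightarrow> fm"  (infix "\<^bold>\<longleftrightarrow>" 50)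
  where "\<phi> \<^bold>\<longleftrightarrow> \<psi> \<equiv> (\<phi> \<^bold>\<longrightarrow> \<psi>) \<^bold>\<and> (\<psi> \<^bold>\<longrightarrow> \<phi>)"

text \<open>
  The bound of a bounded quantifier lies outside its scope: \<open>BUni i \<phi>\<close> is
  \<open>\<forall>x \<in> v\<^sub>i. \<phi>\<close>, where \<open>x\<close> has index 0 and \<open>v\<^sub>i\<close> has index \<open>Suc i\<close> inside \<open>\<phi>\<close>.
\<close>

abbreviation BUni :: "nat \<Rightarrow> fm \<Rightarrow> fm"
  where "BUni i \<phi> \<equiv> \<^bold>\<forall> (0 \<^bold>\<in> Suc i \<^bold>\<longrightarrow> \<phi>)"

abbreviation BExi :: "nat \<Rightarrow> fm \<Rightarrow> fm"
  where "BExi i \<phi> \<equiv> \<^bold>\<exists> (0 \<^bold>\<in> Suc i \<^bold>\<and> \<phi>)"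

primrec fv :: "fm \<Rightarrow> nat set" where
  "fv (i \<^bold>\<in> j) = {i, j}"
| "fv (i \<^bold>= j) = {i, j}"
| "fv \<^bold>\<bottom> = {}"
| "fv (\<phi> \<^bold>\<longrightarrow> \<psi>) = fv \<phi> \<union> fv \<psi>"
| "fv (\<phi> \<^bold>\<and> \<psi>) = fv \<phi> \<union> fv \<psi>"
| "fv (\<phi> \<^bold>\<or> \<psi>) = fv \<phi> \<union> fv \<psi>"
| "fv (\<^bold>\<forall> \<phi>) = {n. Suc n \<in> fv \<phi>}"
| "fv (\<^bold>\<exists> \<phi>) = {n. Suc n \<in> fv \<phi>}"

definition sentence :: "fm \<Rightarrow> bool"
  where "sentence \<phi> \<longleftrightarrow> fv \<phi> = {}"

primrec ren :: "(nat \<Rightarrow> nat) \<Rightarrow> fm \<Rightarrow> fm" where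
  "ren f (i \<^bold>\<in> j) = (f i \<^bold>\<in> f j)"
| "ren f (i \<^bold>= j) = (f i \<^bold>= f j)"
| "ren f \<^bold>\<bottom> = \<^bold>\<bottom>"
| "ren f (\<phi> \<^bold>\<longrightarrow> \<psi>) = (ren f \<phi> \<^bold>\<longrightarrow> ren f \<psi>)"
| "ren f (\<phi> \<^bold>\<and> \<psi>) = (ren f \<phi> \<^bold>\<and> ren f \<psi>)"
| "ren f (\<phi> \<^bold>\<or> \<psi>) = (ren f \<phi> \<^bold>\<or> ren f \<psi>)"
| "ren f (\<^bold>\<forall> \<phi>) = \<^bold>\<forall> (ren (case_nat 0 (\<lambda>n. Suc (f n))) \<phi>)"
| "ren f (\<^bold>\<exists> \<phi>) = \<^bold>\<exists> (ren (case_nat 0 (\<lambda>n. Suc (f n))) \<phi>)"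

text \<open>\<open>inst i \<phi>\<close> substitutes \<open>v\<^sub>i\<close> for the variable bound by the quantifier in \<open>\<^bold>\<forall> \<phi>\<close> or \<open>\<^bold>\<exists> \<phi>\<close>.\<close>

definition inst :: "nat \<Rightarrow> fm \<Rightarrow> fm"
  where "inst i \<phi> = ren (case_nat i (\<lambda>n. n)) \<phi>"


section \<open>Models\<close>

text \<open>
  A structure consists of a carrier \<open>D\<close> and an arbitrary binary relation \<open>E\<close> interpreting
  membership; equality is interpreted as true equality.
\<close>

primrec sat :: "'a set \<Rightarrow> ('a \<Rightarrow> 'a \<Rightarrow> bool) \<Rightarrow> (nat \<Rightarrow> 'a) \<Rightarrow> fm \<Rightarrow> bool" where
  "sat D E e (i \<^bold>\<in> j) \<longleftrightarrow> E (e i) (e j)"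
| "sat D E e (i \<^bold>= j) \<longleftrightarrow> e i = e j"
| "sat D E e \<^bold>\<bottom> \<longleftrightarrow> False"
| "sat D E e (\<phi> \<^bold>\<longrightarrow> \<psi>) \<longleftrightarrow> (sat D E e \<phi> \<longrightarrow> sat D E e \<psi>)"
| "sat D E e (\<phi> \<^bold>\<and> \<psi>) \<longleftrightarrow> sat D E e \<phi> \<and> sat D E e \<psi>"
| "sat D E e (\<phi> \<^bold>\<or> \<psi>) \<longleftrightarrow> sat D E e \<phi> \<or> sat D E e \<psi>"
| "sat D E e (\<^bold>\<forall> \<phi>) \<longleftrightarrow> (\<forall>d\<in>D. sat D E (case_nat d e) \<phi>)"
| "sat D E e (\<^bold>\<exists> \<phi>) \<longleftrightarrow> (\<exists>d\<in>D. sat D E (case_nat d e) \<phi>)"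

definition true_in :: "'a set \<Rightarrow> ('a \<Rightarrow> 'a \<Rightarrow> bool) \<Rightarrow> fm \<Rightarrow> bool"
  where "true_in D E \<phi> \<longleftrightarrow> (\<forall>e. range e \<subseteq> D \<longrightarrow> sat D E e \<phi>)"

definition is_model :: "'a set \<Rightarrow> ('a \<Rightarrow> 'a \<Rightarrow> bool) \<Rightarrow> fm set \<Rightarrow> bool"
  where "is_model D E T \<longleftrightarrow> D \<noteq> {} \<and> (\<forall>\<phi>\<in>T. true_in D E \<phi>)"


section \<open>Provability and consistency\<close>

text \<open>
  Classical natural deduction with equality. Renaming the context by \<open>Suc\<close> makes index 0
  fresh, which is the eigenvariable condition in the rules \<open>UniI\<close> and \<open>ExiE\<close>.
\<close>

inductive proves :: "fm set \<Rightarrow> fm \<Rightarrow> bool"  (infix "\<turnstile>" 40) where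
  Assm: "\<phi> \<in> \<Gamma> \<Longrightarrow> \<Gamma> \<turnstile> \<phi>"
| Raa:  "insert (\<^bold>\<not> \<phi>) \<Gamma> \<turnstile> \<^bold>\<bottom> \<Longrightarrow> \<Gamma> \<turnstile> \<phi>"
| ImpI: "insert \<phi> \<Gamma> \<turnstile> \<psi> \<Longrightarrow> \<Gamma> \<turnstile> \<phi> \<^bold>\<longrightarrow> \<psi>"
| ImpE: "\<Gamma> \<turnstile> \<phi> \<^bold>\<longrightarrow> \<psi> \<Longrightarrow> \<Gamma> \<turnstile> \<phi> \<Longrightarrow> \<Gamma> \<turnstile> \<psi>"
| ConI: "\<Gamma> \<turnstile> \<phi> \<Longrightarrow> \<Gamma> \<turnstile> \<psi> \<Longrightarrow> \<Gamma> \<turnstile> \<phi> \<^bold>\<and> \<psi>"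
| ConE1: "\<Gamma> \<turnstile> \<phi> \<^bold>\<and> \<psi> \<Longrightarrow> \<Gamma> \<turnstile> \<phi>"
| ConE2: "\<Gamma> \<turnstile> \<phi> \<^bold>\<and> \<psi> \<Longrightarrow> \<Gamma> \<turnstile> \<psi>"
| DisI1: "\<Gamma> \<turnstile> \<phi> \<Longrightarrow> \<Gamma> \<turnstile> \<phi> \<^bold>\<or> \<psi>"
| DisI2: "\<Gamma> \<turnstile> \<psi> \<Longrightarrow> \<Gamma> \<turnstile> \<phi> \<^bold>\<or> \<psi>"
| DisE: "\<Gamma> \<turnstile> \<phi> \<^bold>\<or> \<psi> \<Longrightarrow> insert \<phi> \<Gamma> \<turnstile> \<chi> \<Longrightarrow> insert \<psi> \<Gamma> \<turnstile> \<chi> \<Longrightarrow> \<Gamma> \<turnstile> \<chi>"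
| UniI: "ren Suc ` \<Gamma> \<turnstile> \<phi> \<Longrightarrow> \<Gamma> \<turnstile> \<^bold>\<forall> \<phi>"
| UniE: "\<Gamma> \<turnstile> \<^bold>\<forall> \<phi> \<Longrightarrow> \<Gamma> \<turnstile> inst i \<phi>"
| ExiI: "\<Gamma> \<turnstile> inst i \<phi> \<Longrightarrow> \<Gamma> \<turnstile> \<^bold>\<exists> \<phi>"
| ExiE: "\<Gamma> \<turnstile> \<^bold>\<exists> \<phi> \<Longrightarrow> insert \<phi> (ren Suc ` \<Gamma>) \<turnstile> ren Suc \<psi> \<Longrightarrow> \<Gamma> \<turnstile> \<psi>"
| EquI: "\<Gamma> \<turnstile> i \<^bold>= i"
| EquE: "\<Gamma> \<turnstile> i \<^bold>= j \<Longrightarrow> \<Gamma> \<turnstile> inst i \<phi> \<Longrightarrow> \<Gamma> \<turnstile> inst j \<phi>"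

definition consistent :: "fm set \<Rightarrow> bool"
  where "consistent T \<longleftrightarrow> \<not> (T \<turnstile> \<^bold>\<bottom>)"


section \<open>The axioms of ZFC\<close>

definition ax_extensionality :: fm
  where "ax_extensionality = \<^bold>\<forall> (\<^bold>\<forall> (\<^bold>\<forall> (0 \<^bold>\<in> 1 \<^bold>\<longleftrightarrow> 0 \<^bold>\<in> 2) \<^bold>\<longrightarrow> 0 \<^bold>= 1))"

definition ax_foundation :: fm
  where "ax_foundation =
    \<^bold>\<forall> (\<^bold>\<exists> (0 \<^bold>\<in> 1) \<^bold>\<longrightarrow> BExi 0 (\<^bold>\<not> \<^bold>\<exists> (0 \<^bold>\<in> 1 \<^bold>\<and> 0 \<^bold>\<in> 2)))"

definition ax_pairing :: fm
  where "ax_pairing = \<^bold>\<forall> (\<^bold>\<forall> (\<^bold>\<exists> (\<^bold>\<forall> (0 \<^bold>\<in> 1 \<^bold>\<longleftrightarrow> 0 \<^bold>= 2 \<^bold>\<or> 0 \<^bold>= 3))))"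

definition ax_union :: fm
  where "ax_union = \<^bold>\<forall> (\<^bold>\<exists> (\<^bold>\<forall> (0 \<^bold>\<in> 1 \<^bold>\<longleftrightarrow> \<^bold>\<exists> (0 \<^bold>\<in> 3 \<^bold>\<and> 1 \<^bold>\<in> 0))))"

definition ax_power :: fm
  where "ax_power = \<^bold>\<forall> (\<^bold>\<exists> (\<^bold>\<forall> (0 \<^bold>\<in> 1 \<^bold>\<longleftrightarrow> \<^bold>\<forall> (0 \<^bold>\<in> 1 \<^bold>\<longrightarrow> 0 \<^bold>\<in> 3))))"

definition ax_infinity :: fm
  where "ax_infinity =
    \<^bold>\<exists> (BExi 0 (\<^bold>\<forall> (\<^bold>\<not> (0 \<^bold>\<in> 1)))
       \<^bold>\<and> BUni 0 (BExi 1 (\<^bold>\<forall> (0 \<^bold>\<in> 1 \<^bold>\<longleftrightarrow> 0 \<^bold>\<in> 2 \<^bold>\<or> 0 \<^bold>= 2))))"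

text \<open>Every set of nonempty, pairwise disjoint sets has a transversal.\<close>

definition ax_choice :: fm
  where "ax_choice =
    \<^bold>\<forall> (BUni 0 (\<^bold>\<exists> (0 \<^bold>\<in> 1))
        \<^bold>\<and> BUni 0 (BUni 1 (\<^bold>\<exists> (0 \<^bold>\<in> 1 \<^bold>\<and> 0 \<^bold>\<in> 2) \<^bold>\<longrightarrow> 0 \<^bold>= 1))
       \<^bold>\<longrightarrow> \<^bold>\<exists> (BUni 1 (\<^bold>\<exists> (\<^bold>\<forall> (0 \<^bold>\<in> 2 \<^bold>\<and> 0 \<^bold>\<in> 3 \<^bold>\<longleftrightarrow> 0 \<^bold>= 1)))))"

text \<open>
  In the instance of separation for \<open>\<phi>\<close>, the formula \<open>\<phi>\<close> sees the element at index 0, the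
  given set at index 1 and the parameters from index 2 on; the renaming skips the set being
  asserted to exist.
\<close>

definition ax_separation :: "fm \<Rightarrow> fm"
  where "ax_separation \<phi> =
    \<^bold>\<forall> (\<^bold>\<exists> (\<^bold>\<forall> (0 \<^bold>\<in> 1 \<^bold>\<longleftrightarrow> 0 \<^bold>\<in> 2 \<^bold>\<and> ren (case_nat 0 (\<lambda>n. n + 2)) \<phi>)))"

text \<open>
  In the instance of replacement for \<open>\<phi>\<close>, the formula \<open>\<phi>\<close> sees the value at index 0, the
  argument at index 1 and the parameters from index 2 on.
\<close>

definition ax_replacement :: "fm \<Rightarrow> fm"
  where "ax_replacement \<phi> =
    \<^bold>\<forall> (\<^bold>\<forall> (\<^bold>\<forall> (ren Suc \<phi> \<^bold>\<and> ren (case_nat 0 (\<lambda>n. n + 2)) \<phi> \<^bold>\<longrightarrow> 1 \<^bold>= 0)))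
    \<^bold>\<longrightarrow> \<^bold>\<forall> (\<^bold>\<exists> (\<^bold>\<forall> (0 \<^bold>\<in> 1 \<^bold>\<longleftrightarrow>
          \<^bold>\<exists> (0 \<^bold>\<in> 3 \<^bold>\<and> ren (case_nat 1 (case_nat 0 (\<lambda>n. n + 4))) \<phi>))))"

definition closures :: "fm \<Rightarrow> fm set"
  where "closures \<phi> = {\<psi>. sentence \<psi> \<and> (\<exists>k. \<psi> = (Uni ^^ k) \<phi>)}"

definition ZFC :: "fm set"
  where "ZFC = {ax_extensionality, ax_foundation, ax_pairing, ax_union, ax_power,
                ax_infinity, ax_choice}
             \<union> (\<Union>\<phi>. closures (ax_separation \<phi>))
             \<union> (\<Union>\<phi>. closures (ax_replacement \<phi>))"

text \<open>The meaning of the axioms in an arbitrary structure.\<close>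

lemma sat_ren: "sat D E e (ren f \<phi>) \<longleftrightarrow> sat D E (\<lambda>n. e (f n)) \<phi>"
proof (induction \<phi> arbitrary: e f)
  case (Uni \<phi>)
  have "(\<lambda>n. case_nat d e (case_nat 0 (\<lambda>n. Suc (f n)) n)) = case_nat d (\<lambda>n. e (f n))" for d
    by (auto split: nat.split)
  then show ?case by (simp add: Uni)
next
  case (Exi \<phi>)
  have "(\<lambda>n. case_nat d e (case_nat 0 (\<lambda>n. Suc (f n)) n)) = case_nat d (\<lambda>n. e (f n))" for d
    by (auto split: nat.split)
  then show ?case by (simp add: Exi)
qed simp_all

lemma sat_extensionality:
  "sat D E e ax_extensionality \<longleftrightarrow>
    (\<forall>x\<in>D. \<forall>y\<in>D. (\<forall>z\<in>D. E z y \<longleftrightarrow> E z x) \<longrightarrow> y = x)"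
  by (auto simp: ax_extensionality_def eval_nat_numeral)

lemma sat_foundation:
  "sat D E e ax_foundation \<longleftrightarrow>
    (\<forall>x\<in>D. (\<exists>y\<in>D. E y x) \<longrightarrow> (\<exists>y\<in>D. E y x \<and> \<not> (\<exists>z\<in>D. E z y \<and> E z x)))"
  by (auto simp: ax_foundation_def eval_nat_numeral)

lemma sat_pairing:
  "sat D E e ax_pairing \<longleftrightarrow>
    (\<forall>x\<in>D. \<forall>y\<in>D. \<exists>p\<in>D. \<forall>z\<in>D. E z p \<longleftrightarrow> z = y \<or> z = x)"
  by (auto simp: ax_pairing_def eval_nat_numeral iff_conv_conj_imp)

lemma sat_union:
  "sat D E e ax_union \<longleftrightarrow>
    (\<forall>x\<in>D. \<exists>u\<in>D. \<forall>z\<in>D. E z u \<longleftrightarrow> (\<exists>y\<in>D. E y x \<and> E z y))"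
  by (simp add: ax_union_def eval_nat_numeral iff_conv_conj_imp)

lemma sat_power:
  "sat D E e ax_power \<longleftrightarrow>
    (\<forall>x\<in>D. \<exists>p\<in>D. \<forall>z\<in>D. E z p \<longleftrightarrow> (\<forall>w\<in>D. E w z \<longrightarrow> E w x))"
  by (simp add: ax_power_def eval_nat_numeral iff_conv_conj_imp)

lemma sat_infinity:
  "sat D E e ax_infinity \<longleftrightarrow>
    (\<exists>I\<in>D. (\<exists>o'\<in>D. E o' I \<and> (\<forall>z\<in>D. \<not> E z o')) \<and>
      (\<forall>x\<in>D. E x I \<longrightarrow> (\<exists>s\<in>D. E s I \<and> (\<forall>z\<in>D. E z s \<longleftrightarrow> E z x \<or> z = x))))"
  by (simp add: ax_infinity_def eval_nat_numeral iff_conv_conj_imp)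

lemma sat_choice:
  "sat D E e ax_choice \<longleftrightarrow>
    (\<forall>F\<in>D.
      (\<forall>x\<in>D. E x F \<longrightarrow> (\<exists>z\<in>D. E z x)) \<and>
      (\<forall>x\<in>D. E x F \<longrightarrow> (\<forall>y\<in>D. E y F \<longrightarrow> (\<exists>z\<in>D. E z y \<and> E z x) \<longrightarrow> y = x)) \<longrightarrow>
      (\<exists>c\<in>D. \<forall>x\<in>D. E x F \<longrightarrow> (\<exists>w\<in>D. \<forall>z\<in>D. E z x \<and> E z c \<longleftrightarrow> z = w)))"
  by (simp add: ax_choice_def eval_nat_numeral iff_conv_conj_imp)

lemma sat_separation:
  "sat D E e (ax_separation \<phi>) \<longleftrightarrow>
    (\<forall>a\<in>D. \<exists>b\<in>D. \<forall>z\<in>D. E z b \<longleftrightarrow> E z a \<and> sat D E (case_nat z (case_nat a e)) \<phi>)"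
proof -
  have 1: "(\<lambda>n. case_nat z (case_nat b (case_nat a e)) (case_nat 0 (\<lambda>n. n + 2) n))
          = case_nat z (case_nat a e)" for a b z
    by (auto split: nat.split)
  show ?thesis
    unfolding ax_separation_def sat.simps sat_ren 1
    by (simp add: eval_nat_numeral iff_conv_conj_imp)
qed

lemma sat_replacement:
  "sat D E e (ax_replacement \<phi>) \<longleftrightarrow>
    ((\<forall>x\<in>D. \<forall>y\<in>D. \<forall>z\<in>D.
        sat D E (case_nat y (case_nat x e)) \<phi> \<and> sat D E (case_nat z (case_nat x e)) \<phi> \<longrightarrow> y = z)
     \<longrightarrow> (\<forall>a\<in>D. \<exists>b\<in>D. \<forall>y\<in>D.
           E y b \<longleftrightarrow> (\<exists>x\<in>D. E x a \<and> sat D E (case_nat y (case_nat x e)) \<phi>)))"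
proof -
  have 1: "(\<lambda>n. case_nat z (case_nat y (case_nat x e)) (case_nat 0 (\<lambda>n. n + 2) n))
          = case_nat z (case_nat x e)" for x y z
    by (auto split: nat.split)
  have 2: "(\<lambda>n. case_nat x (case_nat y (case_nat b (case_nat a e)))
              (case_nat 1 (case_nat 0 (\<lambda>n. n + 4)) n))
          = case_nat y (case_nat x e)" for a b x y
    by (auto split: nat.split simp: eval_nat_numeral)
  have 3: "(\<lambda>n. case_nat z (case_nat y (case_nat x e)) (Suc n))
          = case_nat y (case_nat x e)" for x y z
    by simp
  show ?thesis
    unfolding ax_replacement_def sat.simps sat_ren 1 2 3
    by (simp add: eval_nat_numeral iff_conv_conj_imp)
qed


section \<open>The Levy hierarchy\<close>

inductive Delta0 :: "fm \<Rightarrow> bool" where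
  "Delta0 (i \<^bold>\<in> j)"
| "Delta0 (i \<^bold>= j)"
| "Delta0 \<^bold>\<bottom>"
| "Delta0 \<phi> \<Longrightarrow> Delta0 \<psi> \<Longrightarrow> Delta0 (\<phi> \<^bold>\<longrightarrow> \<psi>)"
| "Delta0 \<phi> \<Longrightarrow> Delta0 \<psi> \<Longrightarrow> Delta0 (\<phi> \<^bold>\<and> \<psi>)"
| "Delta0 \<phi> \<Longrightarrow> Delta0 \<psi> \<Longrightarrow> Delta0 (\<phi> \<^bold>\<or> \<psi>)"
| "Delta0 \<phi> \<Longrightarrow> Delta0 (BUni i \<phi>)"
| "Delta0 \<phi> \<Longrightarrow> Delta0 (BExi i \<phi>)"

text \<open>
  A \<open>\<Sigma>\<^bsub>n+1\<^esub>\<close> formula is a possibly empty block of existential quantifiers in front of a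
  \<open>\<Pi>\<^sub>n\<close> formula, and dually.
\<close>

inductive levy_Sigma :: "nat \<Rightarrow> fm \<Rightarrow> bool" and levy_Pi :: "nat \<Rightarrow> fm \<Rightarrow> bool" where
  "Delta0 \<phi> \<Longrightarrow> levy_Sigma 0 \<phi>"
| "Delta0 \<phi> \<Longrightarrow> levy_Pi 0 \<phi>"
| "levy_Pi n \<phi> \<Longrightarrow> levy_Sigma (Suc n) \<phi>"
| "levy_Sigma (Suc n) \<phi> \<Longrightarrow> levy_Sigma (Suc n) (\<^bold>\<exists> \<phi>)"
| "levy_Sigma n \<phi> \<Longrightarrow> levy_Pi (Suc n) \<phi>"
| "levy_Pi (Suc n) \<phi> \<Longrightarrow> levy_Pi (Suc n) (\<^bold>\<forall> \<phi>)"

definition Sigma_sentences :: "nat \<Rightarrow> fm set"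
  where "Sigma_sentences n = {\<sigma>. levy_Sigma n \<sigma> \<and> sentence \<sigma>}"


section \<open>Maximal theories\<close>

definition Sigma_theory :: "nat \<Rightarrow> 'a set \<Rightarrow> ('a \<Rightarrow> 'a \<Rightarrow> bool) \<Rightarrow> fm set"
  where "Sigma_theory n D E = {\<sigma> \<in> Sigma_sentences n. true_in D E \<sigma>}"

definition maximal_consistent_Sigma_extension :: "nat \<Rightarrow> fm set \<Rightarrow> bool"
  where "maximal_consistent_Sigma_extension n T \<longleftrightarrow>
    T \<subseteq> Sigma_sentences n \<and> consistent (ZFC \<union> T) \<and>
    (\<forall>\<sigma>\<in>Sigma_sentences n. consistent (ZFC \<union> T \<union> {\<sigma>}) \<longrightarrow> \<sigma> \<in> T)"

definition has_maximal_Sigma_theory :: "nat \<Rightarrow> 'a set \<Rightarrow> ('a \<Rightarrow> 'a \<Rightarrow> bool) \<Rightarrow> bool"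
  where "has_maximal_Sigma_theory n D E \<longleftrightarrow>
    maximal_consistent_Sigma_extension n (Sigma_theory n D E)"

end

theory Submission
  imports Defs "HOL-Library.Countable"
begin

text \<open>
  By Zorn's lemma and the finiteness of proofs there is a set \<open>T\<close> of \<open>\<Sigma>\<^sub>2\<close> sentences that is
  maximal subject to the consistency of \<open>ZFC \<union> T\<close>. The completeness theorem gives a model of
  \<open>ZFC \<union> T\<close>; its \<open>\<Sigma>\<^sub>2\<close> theory contains \<open>T\<close> and is consistent with ZFC by soundness, so it is
  \<open>T\<close>. To have that model on the given type, note that the language is countable, so that the
  term model can be built on natural numbers, and that a type which carries a model of ZFC is
  infinite, because \<open>x \<mapsto> {x}\<close> is injective and misses the empty set.
\<close>

section \<open>Renaming and substitution\<close>

lemma ren_ren: "ren f (ren g \<phi>) = ren (f \<circ> g) \<phi>"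
proof (induction \<phi> arbitrary: f g)
  case (Uni \<phi>)
  have "case_nat 0 (\<lambda>n. Suc (f n)) \<circ> case_nat 0 (\<lambda>n. Suc (g n))
      = case_nat 0 (\<lambda>n. Suc ((f \<circ> g) n))"
    by (auto split: nat.split)
  then show ?case by (simp add: Uni)
next
  case (Exi \<phi>)
  have "case_nat 0 (\<lambda>n. Suc (f n)) \<circ> case_nat 0 (\<lambda>n. Suc (g n))
      = case_nat 0 (\<lambda>n. Suc ((f \<circ> g) n))"
    by (auto split: nat.split)
  then show ?case by (simp add: Exi)
qed simp_all

lemma ren_cong: "(\<And>n. n \<in> fv \<phi> \<Longrightarrow> f n = g n) \<Longrightarrow> ren f \<phi> = ren g \<phi>"
proof (induction \<phi> arbitrary: f g)
  case (Uni \<phi>)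
  show ?case using Uni.prems by (auto intro!: Uni.IH split: nat.split)
next
  case (Exi \<phi>)
  show ?case using Exi.prems by (auto intro!: Exi.IH split: nat.split)
next
  case (Imp \<phi> \<psi>)
  show ?case using Imp.IH[of f g] Imp.prems by simp
next
  case (Con \<phi> \<psi>)
  show ?case using Con.IH[of f g] Con.prems by simp
next
  case (Dis \<phi> \<psi>)
  show ?case using Dis.IH[of f g] Dis.prems by simp
qed simp_all

lemma ren_id: "ren (\<lambda>n. n) \<phi> = \<phi>"
proof (induction \<phi>)
  case (Uni \<phi>)
  have "case_nat 0 (\<lambda>n. Suc n) = (\<lambda>n. n)" by (auto split: nat.split)
  then show ?case by (simp add: Uni)
next
  case (Exi \<phi>)
  have "case_nat 0 (\<lambda>n. Suc n) = (\<lambda>n. n)" by (auto split: nat.split)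
  then show ?case by (simp add: Exi)
qed simp_all

lemma ren_sentence: "sentence \<phi> \<Longrightarrow> ren f \<phi> = \<phi>"
  using ren_cong[of \<phi> f "\<lambda>n. n"] by (simp add: sentence_def ren_id)

text \<open>Both sides send index 0 to \<open>f i\<close> and \<open>Suc n\<close> to
  \<open>f n\<close>. This carries the rules that mention \<open>inst\<close> through
  \<open>proves_ren\<close>.\<close>

lemma ren_inst: "ren f (inst i \<phi>) = inst (f i) (ren (case_nat 0 (\<lambda>n. Suc (f n))) \<phi>)"
  unfolding inst_def ren_ren by (rule ren_cong) (simp split: nat.split)

text \<open>A lifted renaming acts on shifted formulas as \<open>f\<close> followed by the shift, so
  contexts of eigenvariable rules keep their shape under renaming.\<close>

lemma ren_image_lift:
  "ren (case_nat 0 (\<lambda>n. Suc (f n))) ` ren Suc ` \<Gamma> = ren Suc ` ren f ` \<Gamma>"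
  by (simp add: image_image ren_ren comp_def)

lemma inst_ren_lift: "inst i (ren (case_nat 0 (\<lambda>n. Suc (f n))) \<phi>) = ren (case_nat i f) \<phi>"
  unfolding inst_def ren_ren by (rule ren_cong) (simp split: nat.split)

lemma finite_fv: "finite (fv \<phi>)"
proof (induction \<phi>)
  case (Uni \<phi>)
  then show ?case using finite_vimageI[of "fv \<phi>" Suc] by (simp add: vimage_def)
next
  case (Exi \<phi>)
  then show ?case using finite_vimageI[of "fv \<phi>" Suc] by (simp add: vimage_def)
qed simp_all


section \<open>Structural properties of provability\<close>

text \<open>The eigenvariable condition is expressed by the shift of the context, which is monotone,
  so no variable has to be renamed apart when the context grows.\<close>

lemma weakening: "\<Gamma> \<turnstile> \<phi> \<Longrightarrow> \<Gamma> \<subseteq> \<Delta> \<Longrightarrow> \<Delta> \<turnstile> \<phi>"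
proof (induction arbitrary: \<Delta> rule: proves.induct)
  case (Raa \<phi> \<Gamma>)
  then show ?case by (meson insert_mono proves.Raa)
next
  case (ImpI \<phi> \<Gamma> \<psi>)
  then show ?case by (meson insert_mono proves.ImpI)
next
  case (DisE \<Gamma> \<phi> \<psi> \<chi>)
  then show ?case by (meson insert_mono proves.DisE)
next
  case (UniI \<Gamma> \<phi>)
  then show ?case by (meson image_mono proves.UniI)
next
  case (ExiE \<Gamma> \<phi> \<psi>)
  then show ?case by (meson image_mono insert_mono proves.ExiE)
next
  case (EquE \<Gamma> i j \<phi>)
  then show ?case by (meson proves.EquE)
next
  case (ImpE \<Gamma> \<phi> \<psi>)
  then show ?case by (meson proves.ImpE)
next
  case (ConE1 \<Gamma> \<phi> \<psi>)
  then show ?case by (meson proves.ConE1)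
next
  case (ConE2 \<Gamma> \<phi> \<psi>)
  then show ?case by (meson proves.ConE2)
next
  case (ExiI \<Gamma> i \<phi>)
  then show ?case by (meson proves.ExiI)
next
  case (Assm \<phi> \<Gamma>)
  then show ?case by (meson proves.Assm subsetD)
next
  case (ConI \<Gamma> \<phi> \<psi>)
  then show ?case by (meson proves.ConI)
next
  case (DisI1 \<Gamma> \<phi> \<psi>)
  then show ?case by (meson proves.DisI1)
next
  case (DisI2 \<Gamma> \<psi> \<phi>)
  then show ?case by (meson proves.DisI2)
next
  case (UniE \<Gamma> \<phi> i)
  then show ?case by (meson proves.UniE)
next
  case (EquI \<Gamma> i)
  then show ?case by (meson proves.EquI)
qed

text \<open>The renaming need not be injective: under a quantifier rule it is lifted so that it
  fixes the eigenvariable 0.\<close>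

lemma proves_ren: "\<Gamma> \<turnstile> \<phi> \<Longrightarrow> ren f ` \<Gamma> \<turnstile> ren f \<phi>"
proof (induction arbitrary: f rule: proves.induct)
  case (Raa \<phi> \<Gamma>)
  then show ?case by (metis image_insert proves.Raa ren.simps(3,4))
next
  case (UniI \<Gamma> \<phi>)
  then show ?case by (metis proves.UniI ren_image_lift ren.simps(7))
next
  case (UniE \<Gamma> \<phi> i)
  then show ?case by (metis proves.UniE ren_inst ren.simps(7))
next
  case (ExiI \<Gamma> i \<phi>)
  then show ?case by (metis proves.ExiI ren_inst ren.simps(8))
next
  case (ExiE \<Gamma> \<phi> \<psi>)
  let ?g = "case_nat 0 (\<lambda>n. Suc (f n))"
  have "insert (ren ?g \<phi>) (ren Suc ` ren f ` \<Gamma>) \<turnstile> ren ?g (ren Suc \<psi>)"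
    using ExiE.IH(2)[of ?g] by (simp only: image_insert ren_image_lift)
  moreover have "ren ?g (ren Suc \<psi>) = ren Suc (ren f \<psi>)"
    by (simp add: ren_ren comp_def)
  ultimately show ?case
    using proves.ExiE[of "ren f ` \<Gamma>" "ren ?g \<phi>" "ren f \<psi>"] ExiE.IH(1)[of f] by simp
next
  case (EquE \<Gamma> i j \<phi>)
  then show ?case by (metis proves.EquE ren_inst ren.simps(2))
next
  case (ImpE \<Gamma> \<phi> \<psi>)
  then show ?case by (metis proves.ImpE ren.simps(4))
next
  case (DisE \<Gamma> \<phi> \<psi> \<chi>)
  then show ?case by (metis image_insert proves.DisE ren.simps(6))
next
  case (ConE1 \<Gamma> \<phi> \<psi>)
  then show ?case by (metis proves.ConE1 ren.simps(5))
next
  case (ConE2 \<Gamma> \<phi> \<psi>)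
  then show ?case by (metis proves.ConE2 ren.simps(5))
next
  case (Assm \<phi> \<Gamma>)
  then show ?case by (simp add: proves.Assm)
next
  case (ImpI \<phi> \<Gamma> \<psi>)
  then show ?case by (metis image_insert proves.ImpI ren.simps(4))
next
  case (ConI \<Gamma> \<phi> \<psi>)
  then show ?case by (simp add: proves.ConI)
next
  case (DisI1 \<Gamma> \<phi> \<psi>)
  then show ?case by (simp add: proves.DisI1)
next
  case (DisI2 \<Gamma> \<psi> \<phi>)
  then show ?case by (simp add: proves.DisI2)
next
  case (EquI \<Gamma> i)
  then show ?case by (simp add: proves.EquI)
qed

lemma finite_subset_insertE:
  assumes "finite A" "A \<subseteq> insert x B"
  obtains C where "finite C" "C \<subseteq> B" "A \<subseteq> insert x C"
  using assms that[of "A - {x}"] by auto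

lemma finite_common_premises:
  assumes "\<exists>\<Delta>. finite \<Delta> \<and> \<Delta> \<subseteq> \<Gamma> \<and> \<Delta> \<turnstile> \<phi>" "\<exists>\<Delta>. finite \<Delta> \<and> \<Delta> \<subseteq> \<Gamma> \<and> \<Delta> \<turnstile> \<psi>"
  shows "\<exists>\<Delta>. finite \<Delta> \<and> \<Delta> \<subseteq> \<Gamma> \<and> \<Delta> \<turnstile> \<phi> \<and> \<Delta> \<turnstile> \<psi>"
  using assms by (metis finite_UnI Un_least Un_upper1 Un_upper2 weakening)

text \<open>Premises are joined by union. A discharged assumption is split off first, and a finite
  subset of a shifted context is the shift of a finite subset.\<close>

lemma proves_finite: "\<Gamma> \<turnstile> \<phi> \<Longrightarrow> \<exists>\<Delta>. finite \<Delta> \<and> \<Delta> \<subseteq> \<Gamma> \<and> \<Delta> \<turnstile> \<phi>"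
proof (induction rule: proves.induct)
  case (Assm \<phi> \<Gamma>)
  then show ?case by (intro exI[of _ "{\<phi>}"]) (auto intro: proves.Assm)
next
  case (Raa \<phi> \<Gamma>)
  then obtain A where "finite A" "A \<subseteq> insert (\<^bold>\<not> \<phi>) \<Gamma>" "A \<turnstile> \<^bold>\<bottom>" by blast
  then show ?case by (meson finite_subset_insertE weakening proves.Raa)
next
  case (ImpI \<phi> \<Gamma> \<psi>)
  then obtain A where "finite A" "A \<subseteq> insert \<phi> \<Gamma>" "A \<turnstile> \<psi>" by blast
  then show ?case by (meson finite_subset_insertE weakening proves.ImpI)
next
  case (ImpE \<Gamma> \<phi> \<psi>)
  from finite_common_premises[OF ImpE.IH] show ?case by (meson proves.ImpE)
next
  case (ConI \<Gamma> \<phi> \<psi>)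
  from finite_common_premises[OF ConI.IH] show ?case by (meson proves.ConI)
next
  case (DisE \<Gamma> \<phi> \<psi> \<chi>)
  then obtain A B C where A: "finite A" "A \<subseteq> \<Gamma>" "A \<turnstile> \<phi> \<^bold>\<or> \<psi>"
    and B: "finite B" "B \<subseteq> insert \<phi> \<Gamma>" "B \<turnstile> \<chi>"
    and C: "finite C" "C \<subseteq> insert \<psi> \<Gamma>" "C \<turnstile> \<chi>" by blast
  obtain B' where B': "finite B'" "B' \<subseteq> \<Gamma>" "B \<subseteq> insert \<phi> B'"
    using B finite_subset_insertE by meson
  obtain C' where C': "finite C'" "C' \<subseteq> \<Gamma>" "C \<subseteq> insert \<psi> C'"
    using C finite_subset_insertE by meson
  have "A \<union> B' \<union> C' \<turnstile> \<chi>"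
  proof (rule proves.DisE)
    show "A \<union> B' \<union> C' \<turnstile> \<phi> \<^bold>\<or> \<psi>" by (rule weakening[OF A(3)]) auto
    show "insert \<phi> (A \<union> B' \<union> C') \<turnstile> \<chi>" by (rule weakening[OF B(3)]) (use B' in auto)
    show "insert \<psi> (A \<union> B' \<union> C') \<turnstile> \<chi>" by (rule weakening[OF C(3)]) (use C' in auto)
  qed
  then show ?case using A B' C' by (intro exI[of _ "A \<union> B' \<union> C'"]) auto
next
  case (UniI \<Gamma> \<phi>)
  then obtain A where "finite A" "A \<subseteq> ren Suc ` \<Gamma>" "A \<turnstile> \<phi>" by blast
  then show ?case by (metis finite_subset_image proves.UniI)
next
  case (ExiE \<Gamma> \<phi> \<psi>)
  then obtain A B where A: "finite A" "A \<subseteq> \<Gamma>" "A \<turnstile> \<^bold>\<exists> \<phi>"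
    and B: "finite B" "B \<subseteq> insert \<phi> (ren Suc ` \<Gamma>)" "B \<turnstile> ren Suc \<psi>" by blast
  obtain B' where B': "finite B'" "B' \<subseteq> ren Suc ` \<Gamma>" "B \<subseteq> insert \<phi> B'"
    using B finite_subset_insertE by meson
  then obtain C where C: "finite C" "C \<subseteq> \<Gamma>" "B' = ren Suc ` C"
    by (meson finite_subset_image)
  have "A \<union> C \<turnstile> \<psi>"
  proof (rule proves.ExiE)
    show "A \<union> C \<turnstile> \<^bold>\<exists> \<phi>" by (rule weakening[OF A(3)]) auto
    show "insert \<phi> (ren Suc ` (A \<union> C)) \<turnstile> ren Suc \<psi>"
      by (rule weakening[OF B(3)]) (use B' C in auto)
  qed
  then show ?case using A C by (intro exI[of _ "A \<union> C"]) auto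
next
  case (EquE \<Gamma> i j \<phi>)
  from finite_common_premises[OF EquE.IH] show ?case by (meson proves.EquE)
next
  case (EquI \<Gamma> i)
  then show ?case by (meson finite.emptyI empty_subsetI proves.EquI)
next
  case (ConE1 \<Gamma> \<phi> \<psi>)
  then show ?case by (meson proves.ConE1)
next
  case (ConE2 \<Gamma> \<phi> \<psi>)
  then show ?case by (meson proves.ConE2)
next
  case (DisI1 \<Gamma> \<phi> \<psi>)
  then show ?case by (meson proves.DisI1)
next
  case (DisI2 \<Gamma> \<psi> \<phi>)
  then show ?case by (meson proves.DisI2)
next
  case (UniE \<Gamma> \<phi> i)
  then show ?case by (meson proves.UniE)
next
  case (ExiI \<Gamma> i \<phi>)
  then show ?case by (meson proves.ExiI)
qed

text \<open>A refutation uses finitely many premises, and these already lie in one member of a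
  nonempty chain. This serves both Zorn's lemma and the Henkin construction.\<close>

lemma consistent_Union_chain:
  assumes "subset.chain UNIV \<C>" "\<C> \<noteq> {}" "\<And>X. X \<in> \<C> \<Longrightarrow> consistent X"
  shows "consistent (\<Union>\<C>)"
  unfolding consistent_def
proof
  assume "\<Union>\<C> \<turnstile> \<^bold>\<bottom>"
  then obtain \<Delta> where \<Delta>: "finite \<Delta>" "\<Delta> \<subseteq> \<Union>\<C>" "\<Delta> \<turnstile> \<^bold>\<bottom>" using proves_finite by blast
  then obtain X where "X \<in> \<C>" "\<Delta> \<subseteq> X"
    using finite_subset_Union_chain assms(1,2) by metis
  then show False using assms(3) \<Delta>(3) weakening by (meson consistent_def)
qed

lemma consistent_fresh_witness:
  assumes con: "consistent \<Gamma>" and ex: "\<^bold>\<exists> \<phi> \<in> \<Gamma>" and fresh: "\<forall>\<gamma>\<in>\<Gamma>. k \<notin> fv \<gamma>"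
  shows "consistent (insert (inst k \<phi>) \<Gamma>)"
  unfolding consistent_def
proof
  assume bot: "insert (inst k \<phi>) \<Gamma> \<turnstile> \<^bold>\<bottom>"
  \<comment> \<open>This renaming moves the fresh variable k to the eigenvariable position 0 and
    shifts all others, turning the refutation into the minor premise of \<open>ExiE\<close>.\<close>
  define f where "f n = (if n = k then 0 else Suc n)" for n
  \<comment> \<open>Under the quantifier k appears as \<open>Suc k\<close>; its absence makes
    \<open>f\<close> undo the instantiation on all of \<phi>.\<close>
  have "Suc k \<notin> fv \<phi>" using ex fresh by fastforce
  then have "ren f (inst k \<phi>) = ren (\<lambda>n. n) \<phi>"
    unfolding inst_def ren_ren by (intro ren_cong) (auto simp: f_def split: nat.split)
  moreover have "ren f ` \<Gamma> = ren Suc ` \<Gamma>"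
    using fresh by (intro image_cong refl ren_cong) (auto simp: f_def)
  ultimately have "insert \<phi> (ren Suc ` \<Gamma>) \<turnstile> ren Suc \<^bold>\<bottom>"
    using proves_ren[OF bot, of f] by (simp add: ren_id)
  then have "\<Gamma> \<turnstile> \<^bold>\<bottom>" using proves.ExiE proves.Assm[OF ex] by blast
  then show False using con by (simp add: consistent_def)
qed

text \<open>Classical duality of the quantifiers; it provides a counterexample for every universal
  formula outside a Henkin set.\<close>

lemma not_Uni_proves_Exi_not:
  assumes "\<Gamma> \<turnstile> \<^bold>\<not> \<^bold>\<forall> \<phi>"
  shows "\<Gamma> \<turnstile> \<^bold>\<exists> (\<^bold>\<not> \<phi>)"
proof (rule proves.Raa)
  let ?\<Delta> = "insert (\<^bold>\<not> \<^bold>\<exists> (\<^bold>\<not> \<phi>)) \<Gamma>"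
  let ?\<Theta> = "insert (\<^bold>\<not> \<phi>) (ren Suc ` ?\<Delta>)"
  have "?\<Delta> \<turnstile> \<^bold>\<forall> \<phi>"
  proof (rule proves.UniI, rule proves.Raa)
    \<comment> \<open>Shifting below the quantifier and then instantiating with the eigenvariable 0
      gives \<phi> back, so the assumption \<not>\<phi> is itself an instance of the shifted
      existential formula.\<close>
    have "inst 0 (ren (case_nat 0 (\<lambda>n. Suc (Suc n))) \<phi>) = ren (\<lambda>n. n) \<phi>"
      unfolding inst_ren_lift by (rule ren_cong) (simp split: nat.split)
    then have "?\<Theta> \<turnstile> inst 0 (ren (case_nat 0 (\<lambda>n. Suc (Suc n))) (\<^bold>\<not> \<phi>))"
      by (auto simp: ren_id inst_def intro: proves.Assm)
    then have "?\<Theta> \<turnstile> ren Suc (\<^bold>\<exists> (\<^bold>\<not> \<phi>))" by (auto dest: proves.ExiI)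
    moreover have "?\<Theta> \<turnstile> \<^bold>\<not> ren Suc (\<^bold>\<exists> (\<^bold>\<not> \<phi>))" by (auto intro: proves.Assm)
    ultimately show "?\<Theta> \<turnstile> \<^bold>\<bottom>" by (meson proves.ImpE)
  qed
  moreover have "?\<Delta> \<turnstile> \<^bold>\<not> \<^bold>\<forall> \<phi>" using assms weakening by blast
  ultimately show "?\<Delta> \<turnstile> \<^bold>\<bottom>" by (meson proves.ImpE)
qed


section \<open>Soundness\<close>

text \<open>Assignments stay inside \<open>D\<close> because \<open>UniE\<close> and
  \<open>ExiI\<close> instantiate with \<open>e i\<close>, which has to lie in the range of the
  quantifiers.\<close>

lemma soundness:
  "\<Gamma> \<turnstile> \<phi> \<Longrightarrow> range e \<subseteq> D \<Longrightarrow> \<forall>\<gamma>\<in>\<Gamma>. sat D E e \<gamma> \<Longrightarrow> sat D E e \<phi>"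
proof (induction arbitrary: e rule: proves.induct)
  case (UniI \<Gamma> \<phi>)
  have "range (case_nat d e) \<subseteq> D" if "d \<in> D" for d
    using that UniI.prems by (auto simp: image_subset_iff split: nat.split)
  then show ?case using UniI by (auto simp: sat_ren)
next
  case (UniE \<Gamma> \<phi> i)
  have "e i \<in> D" using UniE.prems by blast
  moreover have "(\<lambda>n. e (case_nat i (\<lambda>n. n) n)) = case_nat (e i) e" by (auto split: nat.split)
  ultimately show ?case using UniE by (auto simp: inst_def sat_ren)
next
  case (ExiI \<Gamma> i \<phi>)
  have "e i \<in> D" using ExiI.prems by blast
  moreover have "(\<lambda>n. e (case_nat i (\<lambda>n. n) n)) = case_nat (e i) e" by (auto split: nat.split)
  moreover have "sat D E e (inst i \<phi>)" using ExiI by blast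
  ultimately show ?case by (auto simp: inst_def sat_ren)
next
  case (ExiE \<Gamma> \<phi> \<psi>)
  have "sat D E e (\<^bold>\<exists> \<phi>)" using ExiE by blast
  then obtain d where d: "d \<in> D" "sat D E (case_nat d e) \<phi>" by auto
  moreover have "range (case_nat d e) \<subseteq> D"
    using d ExiE.prems by (auto simp: image_subset_iff split: nat.split)
  ultimately have "sat D E (case_nat d e) (ren Suc \<psi>)"
    using ExiE.IH(2)[of "case_nat d e"] ExiE.prems by (auto simp: sat_ren)
  then show ?case by (simp add: sat_ren)
next
  case (EquE \<Gamma> i j \<phi>)
  have "(\<lambda>n. e (case_nat k (\<lambda>n. n) n)) = case_nat (e k) e" for k by (auto split: nat.split)
  moreover have "e i = e j" "sat D E e (inst i \<phi>)" using EquE.IH EquE.prems by auto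
  ultimately show ?case by (simp add: inst_def sat_ren)
qed auto

lemma consistent_if_model:
  assumes "is_model D E T"
  shows "consistent T"
proof -
  obtain d where "d \<in> D" using assms by (auto simp: is_model_def)
  then have "range (\<lambda>_::nat. d) \<subseteq> D" by auto
  then show ?thesis
    using soundness[of T "\<^bold>\<bottom>" "\<lambda>_. d" D E] assms
    by (auto simp: consistent_def is_model_def true_in_def)
qed


section \<open>Completeness\<close>

lemma sat_cong: "(\<And>n. n \<in> fv \<phi> \<Longrightarrow> e n = e' n) \<Longrightarrow> sat D E e \<phi> \<longleftrightarrow> sat D E e' \<phi>"
proof (induction \<phi> arbitrary: e e')
  case (Uni \<phi>)
  have "sat D E (case_nat d e) \<phi> \<longleftrightarrow> sat D E (case_nat d e') \<phi>" for d
    by (rule Uni.IH) (use Uni.prems in \<open>auto split: nat.split\<close>)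
  then show ?case by simp
next
  case (Exi \<phi>)
  have "sat D E (case_nat d e) \<phi> \<longleftrightarrow> sat D E (case_nat d e') \<phi>" for d
    by (rule Exi.IH) (use Exi.prems in \<open>auto split: nat.split\<close>)
  then show ?case by simp
next
  case (Imp \<phi> \<psi>)
  show ?case using Imp.IH[of e e'] Imp.prems by simp
next
  case (Con \<phi> \<psi>)
  show ?case using Con.IH[of e e'] Con.prems by simp
next
  case (Dis \<phi> \<psi>)
  show ?case using Dis.IH[of e e'] Dis.prems by simp
qed simp_all

lemma sat_sentence: "sentence \<phi> \<Longrightarrow> sat D E e \<phi> \<longleftrightarrow> sat D E e' \<phi>"
  by (rule sat_cong) (simp add: sentence_def)

text \<open>Transport of structure along an injection, with \<open>inv g\<close> as left inverse. It
  moves the term model from the natural numbers to another type.\<close>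

lemma sat_image:
  assumes "inj g"
  shows "sat (g ` D) (\<lambda>x y. E (inv g x) (inv g y)) (\<lambda>n. g (e n)) \<phi> \<longleftrightarrow> sat D E e \<phi>"
proof (induction \<phi> arbitrary: e)
  case (Uni \<phi>)
  have "case_nat (g d) (\<lambda>n. g (e n)) = (\<lambda>n. g (case_nat d e n))" for d by (auto split: nat.split)
  then show ?case by (simp add: Uni)
next
  case (Exi \<phi>)
  have "case_nat (g d) (\<lambda>n. g (e n)) = (\<lambda>n. g (case_nat d e n))" for d by (auto split: nat.split)
  then show ?case by (simp add: Exi)
qed (use assms in \<open>auto simp: inj_eq\<close>)

section \<open>Henkin sets and their term models\<close>

text \<open>The variables themselves play the role of Henkin constants, so the language is not
  extended and witnesses are instances at variables.\<close>

locale Henkin_set =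
  fixes H :: "fm set"
  assumes con: "consistent H"
    and maximal: "consistent (insert \<phi> H) \<Longrightarrow> \<phi> \<in> H"
    and witness: "\<^bold>\<exists> \<phi> \<in> H \<Longrightarrow> \<exists>k. inst k \<phi> \<in> H"
begin

text \<open>Adding a provable formula preserves consistency, since \<open>ImpI\<close> and
  \<open>ImpE\<close> cut it out again; maximality then puts it into \<open>H\<close>.\<close>

lemma mem_iff: "\<phi> \<in> H \<longleftrightarrow> H \<turnstile> \<phi>"
proof
  assume \<phi>: "H \<turnstile> \<phi>"
  have "consistent (insert \<phi> H)"
    unfolding consistent_def
    using \<phi> con proves.ImpI proves.ImpE by (meson consistent_def)
  then show "\<phi> \<in> H" by (rule maximal)
qed (rule proves.Assm)

lemma Bot_notin: "\<^bold>\<bottom> \<notin> H"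
  using con by (simp add: mem_iff consistent_def)

lemma Neg_mem: "\<phi> \<notin> H \<Longrightarrow> \<^bold>\<not> \<phi> \<in> H"
  unfolding mem_iff using maximal[of \<phi>] by (auto simp: consistent_def mem_iff intro: proves.ImpI)

lemma Imp_mem: "\<phi> \<^bold>\<longrightarrow> \<psi> \<in> H \<longleftrightarrow> (\<phi> \<in> H \<longrightarrow> \<psi> \<in> H)"
proof
  show "\<phi> \<^bold>\<longrightarrow> \<psi> \<in> H \<Longrightarrow> \<phi> \<in> H \<longrightarrow> \<psi> \<in> H" by (auto simp: mem_iff intro: proves.ImpE)
next
  assume imp: "\<phi> \<in> H \<longrightarrow> \<psi> \<in> H"
  show "\<phi> \<^bold>\<longrightarrow> \<psi> \<in> H"
  proof (cases "\<phi> \<in> H")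
    case True
    then have "insert \<phi> H \<turnstile> \<psi>" using imp by (auto intro: proves.Assm)
    then show ?thesis by (simp add: mem_iff proves.ImpI)
  next
    case False
    \<comment> \<open>Ex falso is obtained through \<open>Raa\<close>, hence the extra assumption
      \<not>\<psi>.\<close>
    then have "insert (\<^bold>\<not> \<psi>) (insert \<phi> H) \<turnstile> \<^bold>\<not> \<phi>" using Neg_mem by (auto intro: proves.Assm)
    moreover have "insert (\<^bold>\<not> \<psi>) (insert \<phi> H) \<turnstile> \<phi>" by (auto intro: proves.Assm)
    ultimately show ?thesis unfolding mem_iff by (meson proves.ImpE proves.ImpI proves.Raa)
  qed
qed

lemma Con_mem: "\<phi> \<^bold>\<and> \<psi> \<in> H \<longleftrightarrow> \<phi> \<in> H \<and> \<psi> \<in> H"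
  unfolding mem_iff by (meson proves.ConI proves.ConE1 proves.ConE2)

lemma Dis_mem: "\<phi> \<^bold>\<or> \<psi> \<in> H \<longleftrightarrow> \<phi> \<in> H \<or> \<psi> \<in> H"
proof
  assume dis: "\<phi> \<^bold>\<or> \<psi> \<in> H"
  show "\<phi> \<in> H \<or> \<psi> \<in> H"
  proof (rule ccontr)
    assume "\<not> (\<phi> \<in> H \<or> \<psi> \<in> H)"
    then have "insert \<phi> H \<turnstile> \<^bold>\<bottom>" "insert \<psi> H \<turnstile> \<^bold>\<bottom>"
      using maximal by (auto simp: consistent_def)
    then have "H \<turnstile> \<^bold>\<bottom>" using dis mem_iff proves.DisE by blast
    then show False using con by (simp add: consistent_def)
  qed
qed (auto simp: mem_iff intro: proves.DisI1 proves.DisI2)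

lemma Exi_mem: "\<^bold>\<exists> \<phi> \<in> H \<longleftrightarrow> (\<exists>i. inst i \<phi> \<in> H)"
  using witness proves.ExiI mem_iff by blast

lemma Uni_mem: "\<^bold>\<forall> \<phi> \<in> H \<longleftrightarrow> (\<forall>i. inst i \<phi> \<in> H)"
proof
  show "\<^bold>\<forall> \<phi> \<in> H \<Longrightarrow> \<forall>i. inst i \<phi> \<in> H" using proves.UniE mem_iff by blast
next
  assume all: "\<forall>i. inst i \<phi> \<in> H"
  show "\<^bold>\<forall> \<phi> \<in> H"
  proof (rule ccontr)
    assume "\<^bold>\<forall> \<phi> \<notin> H"
    then have "\<^bold>\<exists> (\<^bold>\<not> \<phi>) \<in> H" using Neg_mem not_Uni_proves_Exi_not mem_iff by blast
    then obtain k where "inst k (\<^bold>\<not> \<phi>) \<in> H" using witness by blast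
    then show False using all Bot_notin by (simp add: inst_def Imp_mem)
  qed
qed

lemma Equ_refl: "i \<^bold>= i \<in> H"
  by (simp add: mem_iff proves.EquI)

lemma Equ_subst: "i \<^bold>= j \<in> H \<Longrightarrow> inst i \<phi> \<in> H \<Longrightarrow> inst j \<phi> \<in> H"
  unfolding mem_iff by (rule proves.EquE)

lemma Equ_sym: "i \<^bold>= j \<in> H \<Longrightarrow> j \<^bold>= i \<in> H"
  \<comment> \<open>The template has index 0 as its hole and the shifted parameter i; its instances
    at i and j are reflexivity and the goal.\<close>
  using Equ_subst[of i j "0 \<^bold>= Suc i"] Equ_refl by (simp add: inst_def)

lemma Equ_trans: "i \<^bold>= j \<in> H \<Longrightarrow> j \<^bold>= k \<in> H \<Longrightarrow> i \<^bold>= k \<in> H"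
  using Equ_subst[of j k "Suc i \<^bold>= 0"] by (simp add: inst_def)

text \<open>The term model consists of the least representatives of the classes of variables.\<close>

definition rep :: "nat \<Rightarrow> nat"
  where "rep i = (LEAST j. i \<^bold>= j \<in> H)"

lemma Equ_rep: "i \<^bold>= rep i \<in> H"
  unfolding rep_def by (rule LeastI[of "\<lambda>j. i \<^bold>= j \<in> H", OF Equ_refl])

lemma rep_eq_iff: "rep i = rep j \<longleftrightarrow> i \<^bold>= j \<in> H"
proof
  assume "rep i = rep j"
  then show "i \<^bold>= j \<in> H" using Equ_rep Equ_sym Equ_trans by metis
next
  assume "i \<^bold>= j \<in> H"
  then have "i \<^bold>= k \<in> H \<longleftrightarrow> j \<^bold>= k \<in> H" for k using Equ_sym Equ_trans by blast
  then show "rep i = rep j" by (simp add: rep_def)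
qed

lemma Mem_rep: "rep i \<^bold>\<in> rep j \<in> H \<longleftrightarrow> i \<^bold>\<in> j \<in> H"
proof -
  have "k \<^bold>\<in> l \<in> H \<Longrightarrow> k \<^bold>= k' \<in> H \<Longrightarrow> l \<^bold>= l' \<in> H \<Longrightarrow> k' \<^bold>\<in> l' \<in> H" for k k' l l'
    \<comment> \<open>The left argument is replaced first, then the right one.\<close>
    using Equ_subst[of k k' "0 \<^bold>\<in> Suc l"] Equ_subst[of l l' "Suc k' \<^bold>\<in> 0"]
    by (simp add: inst_def)
  then show ?thesis using Equ_rep Equ_sym by blast
qed

text \<open>The truth lemma. It is stated for every renaming \<open>f\<close> because a quantifier
  turns \<open>f\<close> into \<open>case_nat i f\<close>; each element of the carrier is
  \<open>rep i\<close> for some i, so \<open>Uni_mem\<close> and \<open>Exi_mem\<close>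
  apply.\<close>

lemma sat_term_model:
  "sat (range rep) (\<lambda>i j. i \<^bold>\<in> j \<in> H) (\<lambda>n. rep (f n)) \<phi> \<longleftrightarrow> ren f \<phi> \<in> H"
proof (induction \<phi> arbitrary: f)
  case (Uni \<phi>)
  have "case_nat (rep i) (\<lambda>n. rep (f n)) = (\<lambda>n. rep (case_nat i f n))" for i by (auto split: nat.split)
  then show ?case by (simp add: Uni Uni_mem inst_ren_lift)
next
  case (Exi \<phi>)
  have "case_nat (rep i) (\<lambda>n. rep (f n)) = (\<lambda>n. rep (case_nat i f n))" for i by (auto split: nat.split)
  then show ?case by (simp add: Exi Exi_mem inst_ren_lift)
qed (simp_all add: Mem_rep rep_eq_iff Bot_notin Imp_mem Con_mem Dis_mem)

end

section \<open>Extending a consistent set to a Henkin set\<close>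

instance fm :: countable
  by countable_datatype

text \<open>One stage of the construction. Having only finitely many free variables guarantees a
  fresh witness, and survives because at most two formulas are added.\<close>

lemma extend_with_witness:
  assumes con: "consistent \<Gamma>" and fin: "finite (\<Union>(fv ` \<Gamma>))"
  shows "\<exists>\<Delta>. \<Gamma> \<subseteq> \<Delta> \<and> consistent \<Delta> \<and> finite (\<Union>(fv ` \<Delta>)) \<and>
    (consistent (insert \<phi> \<Gamma>) \<longrightarrow> \<phi> \<in> \<Delta>) \<and>
    (\<phi> \<in> \<Delta> \<longrightarrow> (\<forall>\<psi>. \<phi> = \<^bold>\<exists> \<psi> \<longrightarrow> (\<exists>k. inst k \<psi> \<in> \<Delta>)))"
proof (cases "consistent (insert \<phi> \<Gamma>)")
  case True
  have fin': "finite (\<Union>(fv ` insert \<phi> \<Gamma>))" using fin finite_fv by simp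
  show ?thesis
  proof (cases "\<exists>\<psi>. \<phi> = \<^bold>\<exists> \<psi>")
    case ex: True
    then obtain \<psi> where \<psi>: "\<phi> = \<^bold>\<exists> \<psi>" by blast
    obtain k where "k \<notin> \<Union>(fv ` insert \<phi> \<Gamma>)"
      using ex_new_if_finite[OF infinite_UNIV_nat fin'] by blast
    then have "consistent (insert (inst k \<psi>) (insert \<phi> \<Gamma>))"
      using consistent_fresh_witness[OF True] \<psi> by blast
    moreover have "finite (\<Union>(fv ` insert (inst k \<psi>) (insert \<phi> \<Gamma>)))"
      using fin' finite_fv by simp
    ultimately show ?thesis
      using \<psi> by (intro exI[of _ "insert (inst k \<psi>) (insert \<phi> \<Gamma>)"]) auto
  next
    case False
    then show ?thesis using True fin' by (intro exI[of _ "insert \<phi> \<Gamma>"]) auto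
  qed
next
  case False
  \<comment> \<open>With \<Gamma> left as it is, the witness clause holds vacuously.\<close>
  then have "\<phi> \<notin> \<Gamma>" using con by (auto simp: insert_absorb)
  then show ?thesis using False con fin by (intro exI[of _ \<Gamma>]) simp
qed

lemma Henkin_extension:
  assumes con: "consistent \<Gamma>" and fin: "finite (\<Union>(fv ` \<Gamma>))"
  obtains H where "\<Gamma> \<subseteq> H" "Henkin_set H"
proof -
  let ?P = "\<lambda>n::nat. \<lambda>\<Delta>. \<Gamma> \<subseteq> \<Delta> \<and> consistent \<Delta> \<and> finite (\<Union>(fv ` \<Delta>))"
  \<comment> \<open>Stage n treats the formula with code n; surjectivity of \<open>from_nat\<close>
    ensures that every formula gets its turn.\<close>
  let ?Q = "\<lambda>n \<Delta> \<Delta>'. \<Delta> \<subseteq> \<Delta>' \<and> (consistent (insert (from_nat n) \<Delta>) \<longrightarrow> from_nat n \<in> \<Delta>') \<and>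
    (from_nat n \<in> \<Delta>' \<longrightarrow> (\<forall>\<psi>. from_nat n = \<^bold>\<exists> \<psi> \<longrightarrow> (\<exists>k. inst k \<psi> \<in> \<Delta>')))"
  have "\<exists>S. \<forall>n. ?P n (S n) \<and> ?Q n (S n) (S (Suc n))"
  proof (rule dependent_nat_choice)
    show "\<exists>\<Delta>. ?P 0 \<Delta>" using con fin by blast
    show "\<exists>\<Delta>'. ?P (Suc n) \<Delta>' \<and> ?Q n \<Delta> \<Delta>'" if "?P n \<Delta>" for \<Delta> n
      using extend_with_witness[of \<Delta> "from_nat n"] that by (meson order_trans)
  qed
  then obtain S where S: "\<forall>n. ?P n (S n) \<and> ?Q n (S n) (S (Suc n))" ..
  have P: "?P n (S n)" for n using S by (rule allE[of _ n]) (rule conjunct1)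
  have Q: "?Q n (S n) (S (Suc n))" for n using S by (rule allE[of _ n]) (rule conjunct2)
  have add: "\<phi> \<in> S (Suc (to_nat \<phi>))" if "consistent (insert \<phi> (S (to_nat \<phi>)))" for \<phi>
    using Q[of "to_nat \<phi>"] that by simp
  have add_witness: "\<exists>k. inst k \<psi> \<in> S (Suc (to_nat (\<^bold>\<exists> \<psi>)))"
    if "\<^bold>\<exists> \<psi> \<in> S (Suc (to_nat (\<^bold>\<exists> \<psi>)))" for \<psi>
    using Q[of "to_nat (\<^bold>\<exists> \<psi>)"] that by simp
  define H where "H = \<Union>(range S)"
  have mono: "S m \<subseteq> S n" if "m \<le> n" for m n
  proof (rule lift_Suc_mono_le[OF _ that])
    show "S i \<subseteq> S (Suc i)" for i using Q[of i] by (rule conjunct1)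
  qed
  have "subset.chain UNIV (range S)"
    unfolding subset_chain_def ball_simps using mono nle_le by (metis subset_UNIV)
  then have conH: "consistent H"
    unfolding H_def by (rule consistent_Union_chain) (use P in blast)+
  have sub: "S n \<subseteq> H" for n by (auto simp: H_def)
  have max: "\<phi> \<in> H" if "consistent (insert \<phi> H)" for \<phi>
  proof -
    \<comment> \<open>Consistency with all of \<open>H\<close> implies consistency with the stage
      where \<phi> is treated, so \<phi> was added there.\<close>
    have "consistent (insert \<phi> (S (to_nat \<phi>)))"
      using that sub weakening unfolding consistent_def by (meson insert_mono)
    then show ?thesis using add sub by blast
  qed
  have wit: "\<exists>k. inst k \<phi> \<in> H" if ex: "\<^bold>\<exists> \<phi> \<in> H" for \<phi>
  proof -
    \<comment> \<open>Wherever the existential formula may have entered \<open>H\<close>, it is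
      consistent with the set at its own stage, and is therefore present after that stage together
      with a witness.\<close>
    let ?n = "to_nat (\<^bold>\<exists> \<phi>)"
    have "insert (\<^bold>\<exists> \<phi>) (S ?n) \<subseteq> H" using ex sub by auto
    then have "consistent (insert (\<^bold>\<exists> \<phi>) (S ?n))"
      using conH weakening unfolding consistent_def by blast
    then show ?thesis using add[of "\<^bold>\<exists> \<phi>"] add_witness[of \<phi>] sub by blast
  qed
  have "\<Gamma> \<subseteq> H" using P[of 0] sub[of 0] by blast
  moreover have "Henkin_set H" using conH max wit by unfold_locales
  ultimately show ?thesis by (rule that)
qed

text \<open>Sentences leave all variables free for use as witnesses. The term model lives on natural
  numbers, and an injection into the infinite type \<open>'a\<close> copies it there.\<close>

theorem completeness:
  assumes inf: "infinite (UNIV :: 'a set)"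
    and con: "consistent T" and sen: "\<And>\<phi>. \<phi> \<in> T \<Longrightarrow> sentence \<phi>"
  shows "\<exists>(D :: 'a set) E. is_model D E T"
proof -
  have "\<Union>(fv ` T) = {}" using sen by (auto simp: sentence_def)
  then obtain H where H: "T \<subseteq> H" "Henkin_set H"
    using Henkin_extension[OF con] by auto
  interpret Henkin_set H by (rule H(2))
  obtain g :: "nat \<Rightarrow> 'a" where g: "inj g"
    using infinite_countable_subset[OF inf] by blast
  let ?D = "g ` range rep" and ?E = "\<lambda>x y. inv g x \<^bold>\<in> inv g y \<in> H"
  have "true_in ?D ?E \<phi>" if "\<phi> \<in> T" for \<phi>
  proof -
    have "sat (range rep) (\<lambda>i j. i \<^bold>\<in> j \<in> H) rep \<phi>"
      using sat_term_model[of "\<lambda>n. n"] that H(1) by (auto simp: ren_id)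
    then have "sat ?D ?E (\<lambda>n. g (rep n)) \<phi>"
      by (simp add: sat_image[OF g, where E = "\<lambda>i j. i \<^bold>\<in> j \<in> H"])
    \<comment> \<open>For a sentence, truth under one assignment gives truth under all.\<close>
    then show ?thesis using sat_sentence[OF sen[OF that]] by (auto simp: true_in_def)
  qed
  then have "is_model ?D ?E T" by (simp add: is_model_def)
  then show ?thesis by blast
qed


section \<open>ZFC\<close>

lemma sentence_ZFC: "\<phi> \<in> ZFC \<Longrightarrow> sentence \<phi>"
  by (auto simp: ZFC_def closures_def)
    (auto simp: sentence_def ax_extensionality_def ax_foundation_def ax_pairing_def ax_union_def
      ax_power_def ax_infinity_def ax_choice_def eval_nat_numeral)

lemma infinite_if_ZFC_model:
  assumes "is_model D E ZFC"
  shows "infinite D"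
proof
  assume fin: "finite D"
  obtain d where "d \<in> D" using assms by (auto simp: is_model_def)
  then have sat: "sat D E (\<lambda>_. d) \<phi>" if "\<phi> \<in> ZFC" for \<phi>
    using assms that by (auto simp: is_model_def true_in_def)
  have pairing: "sat D E (\<lambda>_. d) ax_pairing" and infinity: "sat D E (\<lambda>_. d) ax_infinity"
    by (auto intro: sat simp: ZFC_def)
  \<comment> \<open>Pairing x with itself yields its singleton.\<close>
  have "\<exists>p\<in>D. \<forall>z\<in>D. E z p \<longleftrightarrow> z = x" if "x \<in> D" for x
    using pairing[unfolded sat_pairing, rule_format, OF that that] by simp
  then obtain s where s: "\<And>x. x \<in> D \<Longrightarrow> s x \<in> D \<and> (\<forall>z\<in>D. E z (s x) \<longleftrightarrow> z = x)"
    by metis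
  obtain x where x: "x \<in> D" "\<forall>z\<in>D. \<not> E z x"
    using infinity unfolding sat_infinity by blast
  have "inj_on s D" using s by (metis inj_onI)
  \<comment> \<open>On a finite carrier the injective singleton map would be onto, making the empty
    set x a singleton.\<close>
  then have "s ` D = D" using s fin by (intro endo_inj_surj) auto
  then show False using s x by (metis imageE)
qed


section \<open>Maximal theories\<close>

lemma maximal_consistent_Sigma_extension_exists:
  assumes con: "consistent ZFC"
  shows "\<exists>T. maximal_consistent_Sigma_extension n T"
proof -
  let ?A = "{T. T \<subseteq> Sigma_sentences n \<and> consistent (ZFC \<union> T)}"
  have "\<exists>M\<in>?A. \<forall>X\<in>?A. M \<subseteq> X \<longrightarrow> X = M"
  proof (rule subset_Zorn')
    fix C assume C: "subset.chain ?A C"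
    show "\<Union>C \<in> ?A"
    proof (cases "C = {}")
      \<comment> \<open>The empty chain has the empty set as its bound, which is where consistency
        of ZFC itself enters.\<close>
      case True
      then show ?thesis using con by simp
    next
      case False
      have chain: "C \<subseteq> ?A" "\<forall>X\<in>C. \<forall>Y\<in>C. X \<subseteq> Y \<or> Y \<subseteq> X"
        using C unfolding subset_chain_def by simp_all
      \<comment> \<open>Consistency is asserted of the sets \<open>ZFC \<union> X\<close>, so the
        chain is passed to these before taking its union.\<close>
      then have "subset.chain UNIV ((\<union>) ZFC ` C)"
        unfolding subset_chain_def ball_simps by (metis Un_mono subset_UNIV subset_refl)
      then have "consistent (\<Union>((\<union>) ZFC ` C))"
        by (rule consistent_Union_chain) (use False chain in auto)
      moreover have "\<Union>((\<union>) ZFC ` C) = ZFC \<union> \<Union>C" using False by auto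
      ultimately show ?thesis using chain by auto
    qed
  qed
  then obtain T where T: "T \<in> ?A" and max: "\<forall>X\<in>?A. T \<subseteq> X \<longrightarrow> X = T" ..
  have "\<sigma> \<in> T" if "\<sigma> \<in> Sigma_sentences n" "consistent (ZFC \<union> T \<union> {\<sigma>})" for \<sigma>
  proof -
    have "T \<union> {\<sigma>} \<in> ?A" using T that by (simp add: Un_assoc)
    then have "T \<union> {\<sigma>} = T" using max by blast
    then show ?thesis by blast
  qed
  then show ?thesis using T unfolding maximal_consistent_Sigma_extension_def by blast
qed

text \<open>Soundness makes every \<sigma> true in the model consistent with
  \<open>ZFC \<union> T\<close>, so maximality leaves no room for a true sentence outside
  \<open>T\<close>.\<close>

lemma Sigma_theory_eq:
  assumes model: "is_model D E (ZFC \<union> T)" and max: "maximal_consistent_Sigma_extension n T"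
  shows "Sigma_theory n D E = T"
proof
  show "T \<subseteq> Sigma_theory n D E"
    using assms
    by (auto simp: Sigma_theory_def is_model_def maximal_consistent_Sigma_extension_def)
  show "Sigma_theory n D E \<subseteq> T"
  proof
    fix \<sigma> assume \<sigma>: "\<sigma> \<in> Sigma_theory n D E"
    then have "is_model D E (ZFC \<union> T \<union> {\<sigma>})"
      using model by (auto simp: Sigma_theory_def is_model_def)
    then have "consistent (ZFC \<union> T \<union> {\<sigma>})" by (rule consistent_if_model)
    then show "\<sigma> \<in> T"
      using \<sigma> max by (auto simp: Sigma_theory_def maximal_consistent_Sigma_extension_def)
  qed
qed

theorem mainTheorem2:
  assumes "\<exists>(D :: 'a set) E. is_model D E ZFC"
  shows "\<exists>(D :: 'a set) E. is_model D E ZFC \<and> has_maximal_Sigma_theory 2 D E"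
proof -
  obtain D :: "'a set" and E where model: "is_model D E ZFC" using assms by blast
  \<comment> \<open>The new model has to live on the same type as the given one, and completeness
    requires that type to be infinite.\<close>
  have inf: "infinite (UNIV :: 'a set)"
    by (rule infinite_super[OF subset_UNIV infinite_if_ZFC_model[OF model]])
  obtain T where T: "maximal_consistent_Sigma_extension 2 T"
    using maximal_consistent_Sigma_extension_exists consistent_if_model[OF model] by blast
  then have "consistent (ZFC \<union> T)" "\<And>\<phi>. \<phi> \<in> ZFC \<union> T \<Longrightarrow> sentence \<phi>"
    using sentence_ZFC
    by (auto simp: maximal_consistent_Sigma_extension_def Sigma_sentences_def)
  then obtain D' :: "'a set" and E' where model': "is_model D' E' (ZFC \<union> T)"
    using completeness[OF inf] by blast
  \<comment> \<open>The theory of the new model is \<open>T\<close> itself and so inherits its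
    maximality.\<close>
  then have "has_maximal_Sigma_theory 2 D' E'"
    using T by (simp add: has_maximal_Sigma_theory_def Sigma_theory_eq)
  moreover have "is_model D' E' ZFC" using model' by (auto simp: is_model_def)
  ultimately show ?thesis by blast
qed

end
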